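(* For every $n\in\mathbb{Z}$, the Baumslag-Solitar group $B(n,n+2)=\langle a,t \mid ta^{n}t^{-1}=a^{n+2}\rangle$ has a subgroup $\Gamma'$ of index $2$ which is $2$-avoidable, i.e. such that $H_1(\Gamma';\mathbb{Z})$ does not contain $\mathbb{Z}_2$ as a direct summand.
   Context: A group $\Gamma$ is called $2$-avoidable (also: $2$-avoiding) if its abelianization $\Gamma^{ab}=H_1(\Gamma;\mathbb{Z})$ does not contain $\mathbb{Z}_2=\mathbb{Z}/2\mathbb{Z}$ as a direct summand. (The notion is introduced for groups of geometric dimension $2$; here only the homological condition is used.) *)

theory Defs
  imports "HOL-Algebra.Algebra"
begin

text \<open>A letter \<open>(x, True)\<close> stands for the generator \<open>x\<close>, and \<open>(x, False)\<close> for its formal inverse.\<close>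

type_synonym 'g word = "('g \<times> bool) list"

inductive cancel_step :: "'g word \<Rightarrow> 'g word \<Rightarrow> bool" where
  "cancel_step (u @ (x, b) # (x, \<not> b) # v) (u @ v)"

definition free_eq :: "('g word \<times> 'g word) set" where
  "free_eq = {(u, v). equivclp cancel_step u v}"

definition free_group :: "'g word set monoid" where
  "free_group =
    \<lparr>carrier = UNIV // free_eq,
     monoid.mult = (\<lambda>A B. \<Union>u\<in>A. \<Union>v\<in>B. free_eq `` {u @ v}),
     one = free_eq `` {[]}\<rparr>"

definition free_gen :: "'g \<Rightarrow> 'g word set" where
  "free_gen x = free_eq `` {[(x, True)]}"

text \<open>The intersection with the carrier only matters when \<open>R\<close> is not contained in it.\<close>

definition normal_closure :: "('a, 'b) monoid_scheme \<Rightarrow> 'a set \<Rightarrow> 'a set" where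
  "normal_closure G R = carrier G \<inter> \<Inter>{N. N \<lhd> G \<and> R \<subseteq> N}"

text \<open>A pair \<open>(l, r)\<close> encodes the relation \<open>l = r\<close>, that is, the relator \<open>l r\<^sup>-\<^sup>1\<close>.\<close>

definition presented_group :: "('g word set \<times> 'g word set) set \<Rightarrow> 'g word set set monoid" where
  "presented_group R =
    free_group Mod normal_closure free_group {l \<otimes>\<^bsub>free_group\<^esub> inv\<^bsub>free_group\<^esub> r | l r. (l, r) \<in> R}"

datatype bs_gen = Gen_a | Gen_t

definition baumslag_solitar :: "int \<Rightarrow> int \<Rightarrow> bs_gen word set set monoid" where
  "baumslag_solitar m n =
    (let F = free_group; a = free_gen Gen_a; t = free_gen Gen_t
     in presented_group {(t \<otimes>\<^bsub>F\<^esub> a [^]\<^bsub>F\<^esub> m \<otimes>\<^bsub>F\<^esub> inv\<^bsub>F\<^esub> t, a [^]\<^bsub>F\<^esub> n)})"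

definition abelianization :: "('a, 'b) monoid_scheme \<Rightarrow> 'a set monoid" where
  "abelianization G = G Mod derived G (carrier G)"

text \<open>Meant for abelian \<open>A\<close>, where subgroups are normal and so the conditions on \<open>K\<close> and \<open>L\<close> make \<open>A\<close> their
  internal direct sum.\<close>

definition has_direct_summand :: "('a, 'b) monoid_scheme \<Rightarrow> ('c, 'd) monoid_scheme \<Rightarrow> bool" where
  "has_direct_summand A B \<longleftrightarrow>
    (\<exists>K L. subgroup K A \<and> subgroup L A \<and> K \<inter> L = {\<one>\<^bsub>A\<^esub>} \<and> K <#>\<^bsub>A\<^esub> L = carrier A \<and>
      A\<lparr>carrier := K\<rparr> \<cong> B)"

definition two_avoidable :: "('a, 'b) monoid_scheme \<Rightarrow> bool" where
  "two_avoidable G \<longleftrightarrow> \<not> has_direct_summand (abelianization G) (integer_mod_group 2)"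

lemma equiv_free_eq: "equiv UNIV free_eq"
  unfolding free_eq_def
  by (intro equivI refl_onI symI transI) (auto intro: equivclp_sym equivclp_trans)

lemma cancel_step_append:
  assumes "cancel_step u v"
  shows "cancel_step (p @ u @ q) (p @ v @ q)"
  using assms
proof cases
  case (1 u' x b v')
  then show ?thesis
    using cancel_step.intros[of "p @ u'" x b "v' @ q"] by simp
qed

lemma free_eq_append1: "(u, v) \<in> free_eq \<Longrightarrow> (p @ u @ q, p @ v @ q) \<in> free_eq"
proof -
  assume "(u, v) \<in> free_eq"
  then have "equivclp cancel_step u v" by (simp add: free_eq_def)
  then have "equivclp cancel_step (p @ u @ q) (p @ v @ q)"
  proof (induction rule: equivclp_induct)
    case base
    show ?case by simp
  next
    case (step y z)
    then have "cancel_step (p @ y @ q) (p @ z @ q) \<or> cancel_step (p @ z @ q) (p @ y @ q)"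
      using cancel_step_append by blast
    then show ?case using step.IH by (meson equivclp_into_equivclp)
  qed
  then show ?thesis by (simp add: free_eq_def)
qed

lemma free_eq_append:
  assumes "(u, u') \<in> free_eq" "(v, v') \<in> free_eq"
  shows "(u @ v, u' @ v') \<in> free_eq"
proof -
  have "(u @ v, u' @ v) \<in> free_eq" "(u' @ v, u' @ v') \<in> free_eq"
    using free_eq_append1[OF assms(1), of "[]" v] free_eq_append1[OF assms(2), of u' "[]"] by auto
  then show ?thesis using equiv_free_eq by (meson equivE transE)
qed

lemma free_mult_class:
  "free_eq `` {u} \<otimes>\<^bsub>free_group\<^esub> free_eq `` {v} = free_eq `` {u @ v}"
proof -
  have c: "congruent2 free_eq free_eq (\<lambda>u v. free_eq `` {u @ v})"
    unfolding congruent2_def using equiv_class_eq[OF equiv_free_eq] free_eq_append by blast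
  show ?thesis
    unfolding free_group_def using UN_equiv_class2[OF equiv_free_eq equiv_free_eq c] by simp
qed

lemma free_carrier_cases:
  assumes "A \<in> carrier free_group"
  obtains u where "A = free_eq `` {u}"
  using assms unfolding free_group_def by (auto elim: quotientE)

lemma free_class_carrier [simp]: "free_eq `` {u} \<in> carrier free_group"
  unfolding free_group_def by (simp add: quotientI)

lemma free_one: "\<one>\<^bsub>free_group\<^esub> = free_eq `` {[]}"
  by (simp add: free_group_def)

definition word_inv :: "'g word \<Rightarrow> 'g word" where
  "word_inv w = rev (map (\<lambda>(x, b). (x, \<not> b)) w)"

lemma word_inv_left: "(word_inv w @ w, []) \<in> free_eq"
proof (induction w)
  case Nil
  show ?case by (simp add: word_inv_def free_eq_def)
next
  case (Cons l w)
  obtain x b where l: "l = (x, b)" by force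
  have "cancel_step (word_inv w @ (x, \<not> b) # (x, \<not> \<not> b) # w) (word_inv w @ w)"
    by (rule cancel_step.intros)
  then have "(word_inv (l # w) @ l # w, word_inv w @ w) \<in> free_eq"
    by (auto simp: l word_inv_def free_eq_def)
  with Cons show ?case using equiv_free_eq by (meson equivE transE)
qed

lemma group_free_group: "group (free_group :: 'g word set monoid)"
proof (rule groupI)
  fix A :: "'g word set" assume "A \<in> carrier free_group"
  then obtain u where u: "A = free_eq `` {u}" by (rule free_carrier_cases)
  have "free_eq `` {word_inv u} \<otimes>\<^bsub>free_group\<^esub> A = \<one>\<^bsub>free_group\<^esub>"
    unfolding u free_mult_class free_one by (rule equiv_class_eq[OF equiv_free_eq word_inv_left])
  then show "\<exists>B\<in>carrier free_group. B \<otimes>\<^bsub>free_group\<^esub> A = \<one>\<^bsub>free_group\<^esub>"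
    using free_class_carrier by blast
next
  show "\<one>\<^bsub>free_group\<^esub> \<in> carrier (free_group :: 'g word set monoid)" by (simp add: free_one)
qed (auto elim!: free_carrier_cases simp: free_mult_class free_one)

lemma free_gen_carrier [simp]: "free_gen x \<in> carrier free_group"
  by (simp add: free_gen_def)

text \<open>The next two facts together give the universal property of the free group: existence and
  uniqueness of extensions.\<close>

lemma free_group_extend:
  fixes f :: "'g \<Rightarrow> 'h" and H :: "('h, 'i) monoid_scheme"
  assumes "group H" and f: "\<And>x. f x \<in> carrier H"
  obtains h where "h \<in> hom free_group H" and "\<And>x. h (free_gen x) = f x"
proof -
  interpret group H by fact
  define ev where "ev = (\<lambda>w. foldr (\<lambda>(x, b) y. (if b then f x else inv\<^bsub>H\<^esub> f x) \<otimes>\<^bsub>H\<^esub> y) w \<one>\<^bsub>H\<^esub>)"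
  have ev_simps: "ev [] = \<one>\<^bsub>H\<^esub>"
      "ev ((x, b) # w) = (if b then f x else inv\<^bsub>H\<^esub> f x) \<otimes>\<^bsub>H\<^esub> ev w" for x b w
    by (simp_all add: ev_def)
  have ev_closed: "ev w \<in> carrier H" for w
    by (induction w) (auto simp: ev_simps f)
  have ev_append: "ev (u @ v) = ev u \<otimes>\<^bsub>H\<^esub> ev v" for u v
    by (induction u) (auto simp: ev_simps f ev_closed m_assoc)
  have step_eq: "ev u = ev v" if "cancel_step u v" for u v
    using that
  proof cases
    case (1 u' x b v')
    have "f x \<otimes>\<^bsub>H\<^esub> (inv\<^bsub>H\<^esub> f x \<otimes>\<^bsub>H\<^esub> ev v') = ev v'" "inv\<^bsub>H\<^esub> f x \<otimes>\<^bsub>H\<^esub> (f x \<otimes>\<^bsub>H\<^esub> ev v') = ev v'"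
      using f ev_closed by (simp_all flip: m_assoc)
    with 1 show ?thesis by (simp add: ev_append ev_simps)
  qed
  have ev_equivclp: "ev u = ev v" if "equivclp cancel_step u v" for u v
    using that
  proof (induction rule: equivclp_induct)
    case (step y z)
    then show ?case using step_eq[of y z] step_eq[of z y] by metis
  qed (rule refl)
  have ev_eq: "ev u = ev v" if "(u, v) \<in> free_eq" for u v
    using that ev_equivclp by (simp add: free_eq_def)
  define h where "h A = ev (SOME w. w \<in> A)" for A
  have h_class: "h (free_eq `` {u}) = ev u" for u
  proof -
    have "u \<in> free_eq `` {u}" using equiv_class_self[OF equiv_free_eq] by simp
    then have "(SOME w. w \<in> free_eq `` {u}) \<in> free_eq `` {u}" by (rule someI)
    then show ?thesis unfolding h_def using ev_eq by fastforce
  qed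
  show thesis
  proof
    show "h \<in> hom free_group H"
      by (rule homI) (auto elim!: free_carrier_cases simp: h_class free_mult_class ev_closed ev_append)
    show "h (free_gen x) = f x" for x
      by (simp add: free_gen_def h_class ev_simps f)
  qed
qed

lemma generate_free_gens: "generate free_group (range free_gen) = carrier free_group"
proof
  interpret F: group "free_group :: 'g word set monoid" by (rule group_free_group)
  show "generate free_group (range free_gen) \<subseteq> carrier (free_group :: 'g word set monoid)"
    by (rule F.generate_incl) auto
  have inv_gen: "inv\<^bsub>free_group\<^esub> free_gen x = free_eq `` {[(x, False)]}" for x :: 'g
  proof (rule F.inv_equality)
    have "cancel_step [(x, False), (x, True)] []"
      using cancel_step.intros[of "[]" x False "[]"] by simp
    then show "free_eq `` {[(x, False)]} \<otimes>\<^bsub>free_group\<^esub> free_gen x = \<one>\<^bsub>free_group\<^esub>"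
      unfolding free_gen_def free_mult_class free_one
      by (intro equiv_class_eq[OF equiv_free_eq]) (auto simp: free_eq_def)
  qed auto
  have "free_eq `` {w} \<in> generate free_group (range free_gen)" for w :: "'g word"
  proof (induction w)
    case Nil
    show ?case using generate.one[of free_group] by (simp add: free_one)
  next
    case (Cons l w)
    obtain x b where l: "l = (x, b)" by force
    have "free_eq `` {[l]} \<in> generate free_group (range free_gen)"
    proof (cases b)
      case True
      then show ?thesis using generate.incl[of "free_gen x" "range free_gen"]
        by (simp add: l free_gen_def)
    next
      case False
      then show ?thesis using generate.inv[of "free_gen x" "range free_gen" free_group]
        by (simp add: l inv_gen)
    qed
    from generate.eng[OF this Cons] show ?case by (simp add: free_mult_class)
  qed
  then show "carrier (free_group :: 'g word set monoid) \<subseteq> generate free_group (range free_gen)"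
    by (auto elim: free_carrier_cases)
qed

lemma (in group) normal_closure_normal: "normal_closure G R \<lhd> G"
  unfolding normal_inv_iff
proof (intro conjI ballI)
  have sub: "subgroup N G" if "N \<lhd> G" for N using that by (rule normal_imp_subgroup)
  show "subgroup (normal_closure G R) G"
  proof (rule subgroupI)
    have "\<one> \<in> N" if "N \<lhd> G" for N
      using subgroup.one_closed[OF sub[OF that]] .
    then have "\<one> \<in> normal_closure G R" by (simp add: normal_closure_def)
    then show "normal_closure G R \<noteq> {}" by blast
    show "inv x \<in> normal_closure G R" if "x \<in> normal_closure G R" for x
      using that by (simp add: normal_closure_def subgroup.m_inv_closed[OF sub])
    show "x \<otimes> y \<in> normal_closure G R"
      if "x \<in> normal_closure G R" "y \<in> normal_closure G R" for x y
      using that by (simp add: normal_closure_def subgroup.m_closed[OF sub])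
  qed (auto simp: normal_closure_def)
  show "x \<otimes> h \<otimes> inv x \<in> normal_closure G R"
    if "x \<in> carrier G" "h \<in> normal_closure G R" for x h
    using that by (auto simp: normal_closure_def normal_inv_iff)
qed

lemma (in group) normal_closure_incl: "R \<subseteq> carrier G \<Longrightarrow> R \<subseteq> normal_closure G R"
  by (auto simp: normal_closure_def)

lemma group_presented_group: "group (presented_group R)"
  unfolding presented_group_def
  by (rule normal.factorgroup_is_group[OF group.normal_closure_normal[OF group_free_group]])

lemma group_baumslag_solitar: "group (baumslag_solitar m n)"
  by (simp add: baumslag_solitar_def Let_def group_presented_group)

end

theory Submission
  imports Defs
begin

text \<open>Write \<open>\<Gamma> = B(n, n + 2)\<close>. The exponents in the relation have the same parity, so both generators can be sent
  to arbitrary elements of \<open>\<int>/2\<close>, and the parity of \<open>n\<close> decides which kernel to take. An index two kernel of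
  a two-generator group is generated by three explicit words (\<open>index_two_kernel_generators\<close>), so its
  abelianization \<open>A\<close> is easy to bound from above by relations and from below by homomorphisms.

  If \<open>n = 2 k\<close> is even, let \<open>\<Gamma>'\<close> be the kernel of \<open>a \<mapsto> 1, t \<mapsto> 0\<close>. It is generated by \<open>a\<^sup>2\<close>, \<open>t\<close> and
  \<open>u = a t a\<^sup>-\<^sup>1\<close>. The relation says that \<open>t\<close> conjugates the \<open>k\<close>-th power of \<open>a\<^sup>2\<close> to the \<open>(k + 1)\<close>-st, so
  \<open>a\<^sup>2\<close> dies in \<open>A\<close>. The classes of \<open>t\<close> and \<open>u\<close> are independent, since \<open>\<Gamma>\<close> maps onto the wreath product of
  \<open>\<int>\<close> by \<open>\<int>/2\<close> with \<open>t\<close> and \<open>u\<close> going to the standard basis of \<open>\<int> \<times> \<int>\<close>. So \<open>A\<close> is free abelian of rank 2.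

  If \<open>n\<close> is odd, let \<open>\<Gamma>'\<close> be the kernel of \<open>a \<mapsto> 0, t \<mapsto> 1\<close>. It is generated by \<open>s = t\<^sup>2\<close>, \<open>a\<close> and
  \<open>b = t a t\<^sup>-\<^sup>1\<close>. In \<open>A\<close> the relation becomes \<open>n b = (n + 2) a\<close> with coprime coefficients, so \<open>a\<close> and \<open>b\<close> are
  multiples of one element \<open>e\<close>, and \<open>A\<close> is generated by \<open>s\<close>, of infinite order, and \<open>e\<close>. (In fact \<open>e\<close> has
  order \<open>4 \<bar>n + 1\<bar>\<close>, or infinite order if \<open>n = -1\<close>.) What matters is that \<open>e\<close> maps to a generator of \<open>\<int>/4\<close>
  under a homomorphism killing \<open>s\<close>; it is the restriction of the homomorphism from \<open>\<Gamma>\<close> to the semidirect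
  product of \<open>\<int>/4\<close> with \<open>\<int>\<close> that sends \<open>a\<close> to a generator of \<open>\<int>/4\<close> and \<open>t\<close> to an element inverting it.
  The relation holds there because \<open>n + 2\<close> is congruent to \<open>-n\<close> modulo 4.

  In both cases every element of \<open>A\<close> killed by 2 is twice some element. Such an \<open>A\<close> has no summand \<open>\<int>/2\<close>,
  whose nonzero element is killed by 2 but is not divisible by 2
  (\<open>no_Z2_summand_if_involutions_square\<close>).\<close>

section \<open>Direct summands of order two\<close>

text \<open>In a direct product \<open>K L\<close> with \<open>K\<close> of exponent 2, every square lies in \<open>L\<close>. So an element of \<open>K\<close> that is
  a square in the whole group lies in \<open>K \<inter> L\<close> and is trivial.\<close>

lemma (in comm_group) no_Z2_summand_if_involutions_square:
  assumes square: "\<And>x. x \<in> carrier G \<Longrightarrow> x \<otimes> x = \<one> \<Longrightarrow> \<exists>y\<in>carrier G. x = y \<otimes> y"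
  shows "\<not> has_direct_summand G (integer_mod_group 2)"
proof
  assume "has_direct_summand G (integer_mod_group 2)"
  then obtain K L where K: "subgroup K G" and L: "subgroup L G" and KL: "K \<inter> L = {\<one>}"
    and gen: "K <#> L = carrier G" and iso: "G\<lparr>carrier := K\<rparr> \<cong> integer_mod_group 2"
    unfolding has_direct_summand_def by blast
  obtain f where f: "f \<in> iso (G\<lparr>carrier := K\<rparr>) (integer_mod_group 2)"
    using iso unfolding is_iso_def by blast
  have hom: "f (x \<otimes> y) = (f x + f y) mod 2" if "x \<in> K" "y \<in> K" for x y
    using f that by (auto simp: iso_def hom_def)
  have inj: "inj_on f K" and onto: "f ` K = {0..<2}"
    using f by (auto simp: iso_def bij_betw_def carrier_integer_mod_group)
  have sq_K: "x \<otimes> x = \<one>" if "x \<in> K" for x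
  proof (rule inj_onD[OF inj])
    have "\<one> \<in> K" "x \<otimes> x \<in> K"
      using K that by (auto simp: subgroup.one_closed subgroup.m_closed)
    moreover have "f \<one> = 0"
    proof -
      have "f \<one> = (f \<one> + f \<one>) mod 2" "f \<one> \<in> {0..<2}"
        using hom[of \<one> \<one>] \<open>\<one> \<in> K\<close> onto by auto
      then show ?thesis by auto
    qed
    ultimately show "f (x \<otimes> x) = f \<one>" "x \<otimes> x \<in> K" "\<one> \<in> K"
      using hom[of x x] that by auto
  qed
  have "1 \<in> f ` K" "0 \<in> f ` K" using onto by auto
  then obtain x0 x1 where x01: "x0 \<in> K" "x1 \<in> K" "f x0 = 0" "f x1 = 1" by (metis imageE)
  have triv: "x = \<one>" if x: "x \<in> K" for x
  proof -
    have "x \<in> carrier G" using K x by (auto dest: subgroup.subset)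
    then obtain y where y: "y \<in> carrier G" "x = y \<otimes> y"
      using square sq_K[OF x] by blast
    then obtain k l where kl: "k \<in> K" "l \<in> L" "y = k \<otimes> l"
      using gen unfolding set_mult_def by blast
    then have "k \<in> carrier G" "l \<in> carrier G" using K L by (auto dest: subgroup.subset)
    then have "y \<otimes> y = (k \<otimes> k) \<otimes> (l \<otimes> l)" using kl by (simp add: m_ac)
    also have "\<dots> = l \<otimes> l" using sq_K kl \<open>l \<in> carrier G\<close> by simp
    finally have "x \<in> L" using y kl L by (simp add: subgroup.m_closed)
    then show ?thesis using KL x by blast
  qed
  show False using triv[OF x01(1)] triv[OF x01(2)] x01 by simp
qed

section \<open>Abelianizations and index two subgroups\<close>

definition ab_class :: "('a, 'b) monoid_scheme \<Rightarrow> 'a \<Rightarrow> 'a set" where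
  "ab_class G g = derived G (carrier G) #>\<^bsub>G\<^esub> g"

context group
begin

lemma abelianization_comm_group: "comm_group (abelianization G)"
  unfolding abelianization_def by (rule derived_quot_is_comm_group)

lemma ab_class_group_hom: "group_hom G (abelianization G) (ab_class G)"
proof -
  interpret A: comm_group "abelianization G" by (rule abelianization_comm_group)
  interpret D: normal "derived G (carrier G)" G by (rule derived_self_is_normal)
  show ?thesis
    using D.r_coset_hom_Mod
    by unfold_locales (simp add: ab_class_def[abs_def] abelianization_def)
qed

lemma ab_class_surj: "ab_class G ` carrier G = carrier (abelianization G)"
  by (auto simp: ab_class_def abelianization_def carrier_FactGroup)

lemma abelianization_lift:
  assumes "comm_group C" "f \<in> hom G C"
  obtains f' where "f' \<in> hom (abelianization G) C"
    "\<And>x. x \<in> carrier G \<Longrightarrow> f' (ab_class G x) = f x"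
proof -
  interpret C: comm_group C by fact
  interpret f: group_hom G C f by unfold_locales fact
  have "f ` derived G (carrier G) = {\<one>\<^bsub>C\<^esub>}"
    using f.derived_img[of "carrier G"] C.derived_eq_singleton[of "f ` carrier G"] f.img_is_subgroup
    by (simp add: subgroup.subset)
  then have "derived G (carrier G) \<subseteq> kernel G C f"
    using derived_in_carrier[of "carrier G"] by (auto simp: kernel_def)
  from f.FactGroup_universal_kernel[OF derived_self_is_normal this] that show thesis
    unfolding abelianization_def ab_class_def by metis
qed

lemma inv_mult_cancel:
  assumes "c \<in> carrier G" "z \<in> carrier G"
  shows "inv c \<otimes> (c \<otimes> z) = z" "c \<otimes> (inv c \<otimes> z) = z"
  using assms by (simp_all flip: m_assoc)

lemma conjugate_int_pow:
  fixes i :: int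
  assumes "g \<in> carrier G" "h \<in> carrier G"
  shows "(g \<otimes> h \<otimes> inv g) [^] i = g \<otimes> h [^] i \<otimes> inv g"
proof -
  have "(\<lambda>h. g \<otimes> h \<otimes> inv g) \<in> hom G G"
    using assms by (intro homI) (simp_all add: m_assoc inv_mult_cancel)
  from hom_int_pow[OF this assms(2)] show ?thesis by simp
qed

text \<open>These are the Reidemeister-Schreier generators for the transversal \<open>{1, c}\<close>. The argument avoids rewriting
  words: the subgroup \<open>S\<close> they generate is normalized by \<open>c\<close> and contains \<open>c\<^sup>2\<close>, so \<open>S \<union> S c\<close> is a subgroup.
  It contains \<open>c\<close> and \<open>x\<close>, hence is everything, and \<open>S c\<close> misses the kernel.\<close>

lemma index_two_kernel_generators:
  fixes p :: "'a \<Rightarrow> int"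
  assumes p: "p \<in> hom G (integer_mod_group 2)"
    and c: "c \<in> carrier G" "p c = 1" and x: "x \<in> carrier G" "p x = 0"
    and gen: "generate G {c, x} = carrier G"
  shows "kernel G (integer_mod_group 2) p = generate G {c \<otimes> c, x, c \<otimes> x \<otimes> inv c}"
    (is "?K = generate G ?X")
proof
  interpret p: group_hom G "integer_mod_group 2" p
    using p by (simp add: group_hom.intro group_hom_axioms.intro)
  define S where "S = generate G ?X"
  have X: "?X \<subseteq> carrier G" using c x by auto
  have S: "subgroup S G" unfolding S_def using X by (rule generate_is_subgroup)
  have S_gen: "y \<in> S" if "y \<in> ?X" for y unfolding S_def using that by (rule generate.incl)
  note S_mult = subgroup.m_closed[OF S] and S_inv = subgroup.m_inv_closed[OF S]
  have SG [simp]: "s \<in> carrier G" if "s \<in> S" for s using subgroup.subset[OF S] that by auto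
  have kerS: "?X \<subseteq> ?K"
    using c x by (auto simp: kernel_def)
  show "generate G ?X \<subseteq> ?K"
    by (rule generate_subgroup_incl[OF kerS p.subgroup_kernel])
  have cc: "c \<otimes> c \<in> S" and xS: "x \<in> S" using S_gen by auto
  have gens: "c \<otimes> y \<otimes> inv c \<in> S" if "y \<in> ?X" for y
  proof -
    have "c \<otimes> (c \<otimes> c) \<otimes> inv c = c \<otimes> c"
      using c by (simp add: m_assoc)
    moreover have "c \<otimes> (c \<otimes> x \<otimes> inv c) \<otimes> inv c = (c \<otimes> c) \<otimes> x \<otimes> inv (c \<otimes> c)"
      using c x by (simp add: m_assoc inv_mult_group)
    moreover have "(c \<otimes> c) \<otimes> x \<otimes> inv (c \<otimes> c) \<in> S"
      by (rule S_mult[OF S_mult[OF cc xS] S_inv[OF cc]])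
    moreover have "c \<otimes> x \<otimes> inv c \<in> S" by (rule S_gen) simp
    ultimately show ?thesis using that cc by (elim insertE emptyE) (simp_all only:)
  qed
  have conj: "c \<otimes> s \<otimes> inv c \<in> S" if "s \<in> S" for s
    using that unfolding S_def
  proof (induction rule: generate.induct)
    case one
    show ?case using c by (simp add: generate.one)
  next
    case (incl y)
    then show ?case using gens by (simp add: S_def)
  next
    case (inv y)
    then have "y \<in> carrier G" using X by auto
    then have "c \<otimes> inv y \<otimes> inv c = inv (c \<otimes> y \<otimes> inv c)"
      using c by (simp add: inv_mult_group m_assoc)
    then show ?case using gens[OF inv] S_inv by (simp add: S_def)
  next
    case (eng h1 h2)
    then have h: "h1 \<in> carrier G" "h2 \<in> carrier G" using SG by (auto simp: S_def)
    have "c \<otimes> (h1 \<otimes> h2) \<otimes> inv c = (c \<otimes> h1 \<otimes> inv c) \<otimes> (c \<otimes> h2 \<otimes> inv c)"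
      using c h by (simp add: m_assoc inv_mult_cancel)
    then show ?case using generate.eng[OF eng.IH] by simp
  qed
  have conj': "inv c \<otimes> s \<otimes> c \<in> S" if "s \<in> S" for s
  proof -
    have "inv c \<otimes> s \<otimes> c = inv (c \<otimes> c) \<otimes> (c \<otimes> s \<otimes> inv c) \<otimes> (c \<otimes> c)"
      using c that by (simp add: m_assoc inv_mult_group inv_mult_cancel)
    then show ?thesis using S_mult[OF S_mult[OF S_inv[OF cc] conj[OF that]] cc] by simp
  qed
  define T where "T = {g \<in> carrier G. g \<in> S \<or> g \<otimes> inv c \<in> S}"
  have T: "subgroup T G"
  proof (rule subgroupI)
    show "T \<subseteq> carrier G" "T \<noteq> {}" using subgroup.one_closed[OF S] by (auto simp: T_def)
  next
    fix g assume g: "g \<in> T"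
    show "inv g \<in> T"
    proof (cases "g \<in> S")
      case True then show ?thesis using S_inv by (simp add: T_def)
    next
      case False
      then have s: "g \<otimes> inv c \<in> S" "g \<in> carrier G" using g by (auto simp: T_def)
      have "inv g \<otimes> inv c = (inv c \<otimes> inv (g \<otimes> inv c) \<otimes> c) \<otimes> inv (c \<otimes> c)"
        using s c by (simp add: m_assoc inv_mult_group inv_mult_cancel)
      moreover have "\<dots> \<in> S" by (rule S_mult[OF conj'[OF S_inv[OF s(1)]] S_inv[OF cc]])
      ultimately show ?thesis using s by (simp add: T_def)
    qed
  next
    fix g h assume g: "g \<in> T" and h: "h \<in> T"
    then have gh: "g \<in> carrier G" "h \<in> carrier G" by (auto simp: T_def)
    consider "g \<in> S" "h \<in> S" | "g \<in> S" "h \<otimes> inv c \<in> S" | "g \<otimes> inv c \<in> S" "h \<in> S"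
      | "g \<otimes> inv c \<in> S" "h \<otimes> inv c \<in> S" using g h by (auto simp: T_def)
    then show "g \<otimes> h \<in> T"
    proof cases
      case 1
      then show ?thesis using S_mult by (simp add: T_def)
    next
      case 2
      have "g \<otimes> (h \<otimes> inv c) \<in> S" using 2 by (rule S_mult)
      then show ?thesis using gh c by (simp add: T_def m_assoc)
    next
      case 3
      have "(g \<otimes> inv c) \<otimes> (c \<otimes> h \<otimes> inv c) \<in> S" by (rule S_mult[OF 3(1) conj[OF 3(2)]])
      moreover have "(g \<otimes> inv c) \<otimes> (c \<otimes> h \<otimes> inv c) = g \<otimes> h \<otimes> inv c"
        using gh c by (simp add: m_assoc inv_mult_cancel)
      ultimately show ?thesis using gh c by (simp add: T_def m_assoc)
    next
      case 4
      have "(g \<otimes> inv c) \<otimes> (c \<otimes> (h \<otimes> inv c) \<otimes> inv c) \<otimes> (c \<otimes> c) \<in> S"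
        by (rule S_mult[OF S_mult[OF 4(1) conj[OF 4(2)]] cc])
      moreover have "(g \<otimes> inv c) \<otimes> (c \<otimes> (h \<otimes> inv c) \<otimes> inv c) \<otimes> (c \<otimes> c) = g \<otimes> h"
        using gh c by (simp add: m_assoc inv_mult_cancel)
      ultimately show ?thesis using gh c by (simp add: T_def)
    qed
  qed
  have "{c, x} \<subseteq> T"
    using c x xS subgroup.one_closed[OF S] by (auto simp: T_def)
  then have "generate G {c, x} \<subseteq> T" using T by (rule generate_subgroup_incl)
  then have GT: "carrier G \<subseteq> T" unfolding gen .
  show "?K \<subseteq> generate G ?X"
  proof
    fix g assume g: "g \<in> ?K"
    then have gG: "g \<in> carrier G" and "p g = 0" by (auto simp: kernel_def)
    have "g \<otimes> inv c \<notin> S"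
    proof
      assume "g \<otimes> inv c \<in> S"
      then have "g \<otimes> inv c \<in> ?K"
        using \<open>generate G ?X \<subseteq> ?K\<close> by (auto simp: S_def)
      then have "p (g \<otimes> inv c \<otimes> c) = 1"
        using gG c p.hom_mult[of "g \<otimes> inv c" c] by (simp add: kernel_def)
      then show False using \<open>p g = 0\<close> gG c by (simp add: m_assoc)
    qed
    then show "g \<in> generate G ?X" using gG GT by (auto simp: T_def S_def)
  qed
qed

end

section \<open>Abelianizations on two generators\<close>

lemma (in comm_group) conjugate_eq:
  "x \<in> carrier G \<Longrightarrow> y \<in> carrier G \<Longrightarrow> x \<otimes> y \<otimes> inv x = y"
  by (simp add: m_comm[of x y] m_assoc)

lemma (in comm_group) products_of_powers_subgroup:
  assumes "x \<in> carrier G" "y \<in> carrier G"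
  shows "subgroup {x [^] (i::int) \<otimes> y [^] (j::int) | i j. True} G" (is "subgroup ?S G")
proof (rule subgroupI)
  show "?S \<subseteq> carrier G" "?S \<noteq> {}" using assms by auto
next
  fix g assume "g \<in> ?S"
  then obtain i j :: int where "g = x [^] i \<otimes> y [^] j" by blast
  then have "inv g = x [^] (-i) \<otimes> y [^] (-j)" using assms by (simp add: inv_mult int_pow_neg)
  then show "inv g \<in> ?S" by blast
next
  fix g h assume "g \<in> ?S" "h \<in> ?S"
  then obtain i j k l :: int where "g = x [^] i \<otimes> y [^] j" "h = x [^] k \<otimes> y [^] l" by blast
  then have "g \<otimes> h = x [^] (i + k) \<otimes> y [^] (j + l)" using assms by (simp add: int_pow_mult m_ac)
  then show "g \<otimes> h \<in> ?S" by blast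
qed

lemma hom_two_powers:
  assumes "group G" "group H" "f \<in> hom G H" "x \<in> carrier G" "y \<in> carrier G"
  shows "f (x [^]\<^bsub>G\<^esub> (i::int) \<otimes>\<^bsub>G\<^esub> y [^]\<^bsub>G\<^esub> (j::int)) = f x [^]\<^bsub>H\<^esub> i \<otimes>\<^bsub>H\<^esub> f y [^]\<^bsub>H\<^esub> j"
  using assms by (simp add: hom_mult hom_int_pow group.int_pow_closed)

text \<open>The relation kills the class of \<open>z\<close>, so the abelianization is generated by the classes of \<open>x\<close> and \<open>y\<close>,
  and the two homomorphisms read off their exponents. Thus the abelianization is \<open>\<int> \<times> \<int>\<close>, where no nonzero
  element is killed by 2.\<close>

lemma two_avoidable_free_abelianization:
  fixes G (structure) and k :: int
  assumes "group G" and gens: "generate G {z, x, y} = carrier G"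
    and xyz: "x \<in> carrier G" "y \<in> carrier G" "z \<in> carrier G"
    and rel: "x \<otimes> z [^] k \<otimes> inv x = z [^] (k + 1)"
    and f1: "f1 \<in> hom G integer_group" "f1 x = 1" "f1 y = 0"
    and f2: "f2 \<in> hom G integer_group" "f2 x = 0" "f2 y = 1"
  shows "two_avoidable G"
proof -
  interpret group G by fact
  interpret A: comm_group "abelianization G" by (rule abelianization_comm_group)
  interpret q: group_hom G "abelianization G" "ab_class G" by (rule ab_class_group_hom)
  let ?A = "abelianization G" and ?q = "ab_class G"
  have "?q (x \<otimes> z [^] k \<otimes> inv x) = ?q z [^]\<^bsub>?A\<^esub> k"
    using xyz by (simp add: q.hom_int_pow A.conjugate_eq)
  moreover have "?q (z [^] (k + 1)) = ?q z [^]\<^bsub>?A\<^esub> k \<otimes>\<^bsub>?A\<^esub> ?q z"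
    using xyz by (simp add: q.hom_int_pow A.int_pow_mult)
  ultimately have z1: "?q z = \<one>\<^bsub>?A\<^esub>"
    using rel xyz by (simp add: A.r_cancel_one)
  let ?S = "{?q x [^]\<^bsub>?A\<^esub> (i::int) \<otimes>\<^bsub>?A\<^esub> ?q y [^]\<^bsub>?A\<^esub> (j::int) | i j. True}"
  have S: "subgroup ?S ?A" using xyz by (intro A.products_of_powers_subgroup) auto
  have "?q x = ?q x [^]\<^bsub>?A\<^esub> (1::int) \<otimes>\<^bsub>?A\<^esub> ?q y [^]\<^bsub>?A\<^esub> (0::int)"
    "?q y = ?q x [^]\<^bsub>?A\<^esub> (0::int) \<otimes>\<^bsub>?A\<^esub> ?q y [^]\<^bsub>?A\<^esub> (1::int)" using xyz by auto
  then have "?q x \<in> ?S" "?q y \<in> ?S" by blast+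
  moreover have "?q z \<in> ?S" unfolding z1 by (rule subgroup.one_closed[OF S])
  ultimately have "?q ` {z, x, y} \<subseteq> ?S" by blast
  then have "generate ?A (?q ` {z, x, y}) \<subseteq> ?S" using S by (rule A.generate_subgroup_incl)
  moreover have "generate ?A (?q ` {z, x, y}) = carrier ?A"
    using q.generate_img[of "{z, x, y}"] xyz gens ab_class_surj by simp
  ultimately have AS: "carrier ?A \<subseteq> ?S" by simp
  obtain g1 where g1: "g1 \<in> hom ?A integer_group" "\<And>x. x \<in> carrier G \<Longrightarrow> g1 (?q x) = f1 x"
    using abelianization_lift[OF abelian_integer_group f1(1)] by blast
  obtain g2 where g2: "g2 \<in> hom ?A integer_group" "\<And>x. x \<in> carrier G \<Longrightarrow> g2 (?q x) = f2 x"
    using abelianization_lift[OF abelian_integer_group f2(1)] by blast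
  have val: "g1 (?q x [^]\<^bsub>?A\<^esub> (i::int) \<otimes>\<^bsub>?A\<^esub> ?q y [^]\<^bsub>?A\<^esub> (j::int)) = i"
    "g2 (?q x [^]\<^bsub>?A\<^esub> (i::int) \<otimes>\<^bsub>?A\<^esub> ?q y [^]\<^bsub>?A\<^esub> (j::int)) = j" for i j
    using xyz by (simp_all add: hom_two_powers[OF A.is_group group_integer_group] g1 g2 f1 f2)
  show ?thesis unfolding two_avoidable_def
  proof (rule A.no_Z2_summand_if_involutions_square)
    fix w assume w: "w \<in> carrier ?A" "w \<otimes>\<^bsub>?A\<^esub> w = \<one>\<^bsub>?A\<^esub>"
    then obtain i j :: int where ij: "w = ?q x [^]\<^bsub>?A\<^esub> i \<otimes>\<^bsub>?A\<^esub> ?q y [^]\<^bsub>?A\<^esub> j" using AS by blast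
    have "g1 w = i" "g2 w = j" unfolding ij by (rule val)+
    moreover have "g1 w + g1 w = 0" "g2 w + g2 w = 0"
      using w hom_mult[OF g1(1) w(1) w(1)] hom_mult[OF g2(1) w(1) w(1)]
        hom_one[OF g1(1)] hom_one[OF g2(1)] by simp_all
    ultimately have "i = 0" "j = 0" by simp_all
    then have "w = \<one>\<^bsub>?A\<^esub>" using ij by simp
    then show "\<exists>y\<in>carrier ?A. w = y \<otimes>\<^bsub>?A\<^esub> y" using w by metis
  qed
qed

text \<open>Additively, the relation is \<open>n b = (n + 2) a\<close>. As \<open>n\<close> is odd, \<open>n\<close> and \<open>n + 2\<close> are coprime, so \<open>a\<close> and \<open>b\<close>
  are multiples of a single element. It is found by the Euclidean algorithm: with \<open>c = b - a\<close> the relation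
  reads \<open>n c = 2 a\<close>, so \<open>e = a - k c\<close> satisfies \<open>2 e = n c - 2 k c = c\<close>.\<close>

lemma (in comm_group) common_root_of_coprime_powers:
  fixes n k :: int
  assumes ab: "a \<in> carrier G" "b \<in> carrier G" and n: "n = 2 * k + 1"
    and rel: "b [^] n = a [^] (n + 2)"
  defines "e \<equiv> a [^] (1 + k) \<otimes> b [^] (- k)"
  shows "a = e [^] n" "b = e [^] (n + 2)"
proof -
  have swap: "(u [^] i) [^] j = (u [^] j) [^] i" if "u \<in> carrier G" for u and i j :: int
    using that by (simp add: int_pow_pow mult.commute)
  have "e [^] n = (a [^] n) [^] (1 + k) \<otimes> (b [^] n) [^] (- k)"
    using ab by (simp add: e_def int_pow_distrib swap)
  also have "\<dots> = a [^] (n * (1 + k) + (n + 2) * (- k))"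
    unfolding rel using ab by (simp only: int_pow_pow flip: int_pow_mult)
  also have "n * (1 + k) + (n + 2) * (- k) = 1" by (simp add: n algebra_simps)
  finally show "a = e [^] n" using ab by simp
  have "e [^] (n + 2) = (a [^] (n + 2)) [^] (1 + k) \<otimes> (b [^] (n + 2)) [^] (- k)"
    using ab by (simp add: e_def int_pow_distrib swap)
  also have "\<dots> = (b [^] n) [^] (1 + k) \<otimes> (b [^] (n + 2)) [^] (- k)"
    using rel by simp
  also have "\<dots> = b [^] (n * (1 + k) + (n + 2) * (- k))"
    using ab by (simp only: int_pow_pow flip: int_pow_mult)
  also have "n * (1 + k) + (n + 2) * (- k) = 1" by (simp add: n algebra_simps)
  finally show "b = e [^] (n + 2)" using ab by simp
qed

lemma abelian_integer_mod_group: "comm_group (integer_mod_group n)"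
  by (rule group.group_comm_groupI) (simp_all add: add.commute)

text \<open>The abelianization is generated by \<open>s\<close> and the common root \<open>e\<close> of \<open>a\<close> and \<open>b\<close>. The homomorphism \<open>f\<close> shows
  that torsion elements are powers of \<open>e\<close>, while \<open>r\<close> sends \<open>e\<close> to a generator of \<open>\<int>/4\<close>. So if the square of
  \<open>e\<close> to the power \<open>j\<close> is trivial, then \<open>j\<close> is even.\<close>

lemma two_avoidable_cyclic_torsion:
  fixes G (structure) and n :: int
  assumes "group G" and gens: "generate G {s, a, b} = carrier G"
    and sab: "s \<in> carrier G" "a \<in> carrier G" "b \<in> carrier G"
    and n: "odd n"
    and rel: "b [^] n = a [^] (n + 2)"
    and f: "f \<in> hom G integer_group" "f s \<noteq> 0" "f a = 0" "f b = 0"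
    and r: "r \<in> hom G (integer_mod_group 4)" "r a = 1" "r b = 3"
  shows "two_avoidable G"
proof -
  interpret group G by fact
  interpret A: comm_group "abelianization G" by (rule abelianization_comm_group)
  interpret q: group_hom G "abelianization G" "ab_class G" by (rule ab_class_group_hom)
  let ?A = "abelianization G" and ?q = "ab_class G"
  obtain k where k: "n = 2 * k + 1" using n by (rule oddE)
  define e where "e = ?q a [^]\<^bsub>?A\<^esub> (1 + k) \<otimes>\<^bsub>?A\<^esub> ?q b [^]\<^bsub>?A\<^esub> (- k)"
  have e: "e \<in> carrier ?A" using sab by (simp add: e_def)
  have q_rel: "?q b [^]\<^bsub>?A\<^esub> n = ?q a [^]\<^bsub>?A\<^esub> (n + 2)"
    using rel sab by (simp flip: q.hom_int_pow)
  have qa: "?q a = e [^]\<^bsub>?A\<^esub> n" and qb: "?q b = e [^]\<^bsub>?A\<^esub> (n + 2)"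
    using A.common_root_of_coprime_powers[OF _ _ k q_rel] sab by (simp_all add: e_def)
  let ?S = "{?q s [^]\<^bsub>?A\<^esub> (i::int) \<otimes>\<^bsub>?A\<^esub> e [^]\<^bsub>?A\<^esub> (j::int) | i j. True}"
  have S: "subgroup ?S ?A" using sab e by (intro A.products_of_powers_subgroup) auto
  have "?q s = ?q s [^]\<^bsub>?A\<^esub> (1::int) \<otimes>\<^bsub>?A\<^esub> e [^]\<^bsub>?A\<^esub> (0::int)"
    "?q a = ?q s [^]\<^bsub>?A\<^esub> (0::int) \<otimes>\<^bsub>?A\<^esub> e [^]\<^bsub>?A\<^esub> n"
    "?q b = ?q s [^]\<^bsub>?A\<^esub> (0::int) \<otimes>\<^bsub>?A\<^esub> e [^]\<^bsub>?A\<^esub> (n + 2)"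
    using sab e by (simp_all flip: qa qb)
  then have "?q ` {s, a, b} \<subseteq> ?S" by blast
  then have "generate ?A (?q ` {s, a, b}) \<subseteq> ?S" using S by (rule A.generate_subgroup_incl)
  moreover have "generate ?A (?q ` {s, a, b}) = carrier ?A"
    using q.generate_img[of "{s, a, b}"] sab gens ab_class_surj by simp
  ultimately have AS: "carrier ?A \<subseteq> ?S" by simp
  obtain f' where f': "f' \<in> hom ?A integer_group" "\<And>x. x \<in> carrier G \<Longrightarrow> f' (?q x) = f x"
    using abelianization_lift[OF abelian_integer_group f(1)] by blast
  obtain r' where r': "r' \<in> hom ?A (integer_mod_group 4)" "\<And>x. x \<in> carrier G \<Longrightarrow> r' (?q x) = r x"
    using abelianization_lift[OF abelian_integer_mod_group r(1)] by blast
  have fe: "f' e = 0"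
    unfolding e_def using sab
    by (simp add: hom_two_powers[OF A.is_group group_integer_group] f' f)
  \<comment> \<open>Additively, \<open>e = (1 + k) a - k b\<close>, where \<open>r\<close> takes the values 1 and 3 at \<open>a\<close> and \<open>b\<close>.\<close>
  have "r' e = (1 + k - 3 * k) mod 4"
    unfolding e_def using sab
    by (simp add: hom_two_powers[OF A.is_group group_integer_mod_group r'(1)] r'(2) r
        int_pow_integer_mod_group mod_simps)
  then have re: "odd (r' e)" by presburger
  show ?thesis unfolding two_avoidable_def
  proof (rule A.no_Z2_summand_if_involutions_square)
    fix w assume w: "w \<in> carrier ?A" "w \<otimes>\<^bsub>?A\<^esub> w = \<one>\<^bsub>?A\<^esub>"
    then obtain i j :: int where ij: "w = ?q s [^]\<^bsub>?A\<^esub> i \<otimes>\<^bsub>?A\<^esub> e [^]\<^bsub>?A\<^esub> j" using AS by blast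
    have "f' w = i * f s"
      using sab e by (simp add: ij hom_two_powers[OF A.is_group group_integer_group] f' fe)
    moreover have "f' w + f' w = 0"
      using w hom_mult[OF f'(1) w(1) w(1)] hom_one[OF f'(1)] by simp
    ultimately have "i = 0" using f(2) by simp
    then have wj: "w = e [^]\<^bsub>?A\<^esub> j" using ij e by simp
    have "r' w = (j * r' e) mod 4"
      using e by (simp add: wj hom_int_pow[OF r'(1)] int_pow_integer_mod_group A.is_group)
    moreover have "(r' w + r' w) mod 4 = 0"
      using w hom_mult[OF r'(1) w(1) w(1)] hom_one[OF r'(1)] by simp
    moreover have "even m" if "(m mod 4 + m mod 4) mod 4 = 0" for m :: int using that by presburger
    ultimately have "even (j * r' e)" by metis
    then have "even j" using re by simp
    then obtain l where "j = l + l" by (metis evenE mult_2)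
    then have "w = e [^]\<^bsub>?A\<^esub> l \<otimes>\<^bsub>?A\<^esub> e [^]\<^bsub>?A\<^esub> l"
      using e wj by (simp only: A.int_pow_mult)
    then show "\<exists>y\<in>carrier ?A. w = y \<otimes>\<^bsub>?A\<^esub> y"
      using e by blast
  qed
qed

section \<open>Group presentations\<close>

definition relators :: "('g word set \<times> 'g word set) set \<Rightarrow> 'g word set set" where
  "relators R = {l \<otimes>\<^bsub>free_group\<^esub> inv\<^bsub>free_group\<^esub> r | l r. (l, r) \<in> R}"

definition presented_class :: "('g word set \<times> 'g word set) set \<Rightarrow> 'g word set \<Rightarrow> 'g word set set" where
  "presented_class R w = normal_closure free_group (relators R) #>\<^bsub>free_group\<^esub> w"

lemma presented_group_relators:
  "presented_group R = free_group Mod normal_closure free_group (relators R)"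
  by (simp add: presented_group_def relators_def)

lemma relators_normal_closure: "normal_closure free_group (relators R) \<lhd> free_group"
  by (rule group.normal_closure_normal[OF group_free_group])

lemma presented_class_group_hom:
  "group_hom free_group (presented_group R) (presented_class R)"
proof -
  interpret N: normal "normal_closure free_group (relators R)" free_group
    by (rule relators_normal_closure)
  show ?thesis
    using N.r_coset_hom_Mod group_free_group group_presented_group[of R]
    by (simp add: group_hom_def group_hom_axioms_def presented_class_def[abs_def]
        presented_group_relators)
qed

lemma presented_class_relation:
  assumes "R \<subseteq> carrier free_group \<times> carrier free_group" "(l, r) \<in> R"
  shows "presented_class R l = presented_class R r"
proof -
  interpret F: group free_group by (rule group_free_group)
  interpret N: normal "normal_closure free_group (relators R)" free_group
    by (rule relators_normal_closure)
  have lr: "l \<in> carrier free_group" "r \<in> carrier free_group" using assms by auto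
  have "relators R \<subseteq> carrier free_group"
    using assms(1) by (auto simp: relators_def)
  then have "relators R \<subseteq> normal_closure free_group (relators R)"
    by (rule F.normal_closure_incl)
  moreover have "l \<otimes>\<^bsub>free_group\<^esub> inv\<^bsub>free_group\<^esub> r \<in> relators R"
    using assms(2) by (auto simp: relators_def)
  ultimately have "l \<otimes>\<^bsub>free_group\<^esub> inv\<^bsub>free_group\<^esub> r \<in> normal_closure free_group (relators R)"
    by blast
  then have "l \<in> normal_closure free_group (relators R) #>\<^bsub>free_group\<^esub> r"
    using N.rcos_module_rev[OF F.is_group] lr by blast
  then show ?thesis
    unfolding presented_class_def
    using F.repr_independence lr N.subgroup_axioms by metis
qed

lemma generate_presented_gens:
  "generate (presented_group R) (range (\<lambda>x. presented_class R (free_gen x))) = carrier (presented_group R)"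
proof -
  interpret q: group_hom free_group "presented_group R" "presented_class R"
    by (rule presented_class_group_hom)
  have "generate (presented_group R) (presented_class R ` range free_gen)
      = presented_class R ` carrier free_group"
    using q.generate_img[of "range free_gen"] by (simp add: generate_free_gens image_subset_iff)
  also have "\<dots> = carrier (presented_group R)"
    by (auto simp: presented_group_relators carrier_FactGroup presented_class_def)
  finally show ?thesis by (simp add: image_image)
qed

text \<open>This is the existence half of the universal property of a presentation: the kernel of \<open>f\<close> is a normal
  subgroup containing the relators, hence contains their normal closure.\<close>

lemma presented_group_lift:
  fixes f :: "'g word set \<Rightarrow> 'h"
  assumes "group H" "f \<in> hom free_group H" "R \<subseteq> carrier free_group \<times> carrier free_group"
    and rel: "\<And>l r. (l, r) \<in> R \<Longrightarrow> f l = f r"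
  obtains f' where "f' \<in> hom (presented_group R) H"
    "\<And>w. w \<in> carrier free_group \<Longrightarrow> f' (presented_class R w) = f w"
proof -
  interpret f: group_hom free_group H f
    using assms group_free_group by (simp add: group_hom_def group_hom_axioms_def)
  have "relators R \<subseteq> kernel free_group H f"
    using assms(3) rel by (fastforce simp: relators_def kernel_def)
  then have "normal_closure free_group (relators R) \<subseteq> kernel free_group H f"
    using f.normal_kernel by (auto simp: normal_closure_def)
  from f.FactGroup_universal_kernel[OF relators_normal_closure this] that show thesis
    unfolding presented_group_relators presented_class_def by metis
qed

definition bs_class :: "int \<Rightarrow> int \<Rightarrow> bs_gen \<Rightarrow> bs_gen word set set" where
  "bs_class m n x =
    presented_class {(free_gen Gen_t \<otimes>\<^bsub>free_group\<^esub> free_gen Gen_a [^]\<^bsub>free_group\<^esub> m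
      \<otimes>\<^bsub>free_group\<^esub> inv\<^bsub>free_group\<^esub> free_gen Gen_t, free_gen Gen_a [^]\<^bsub>free_group\<^esub> n)} (free_gen x)"

context
  fixes m n :: int and R B
  defines "R \<equiv> {(free_gen Gen_t \<otimes>\<^bsub>free_group\<^esub> free_gen Gen_a [^]\<^bsub>free_group\<^esub> m
      \<otimes>\<^bsub>free_group\<^esub> inv\<^bsub>free_group\<^esub> free_gen Gen_t, free_gen Gen_a [^]\<^bsub>free_group\<^esub> n)}"
    and "B \<equiv> baumslag_solitar m n"
begin

lemma bs_presented: "B = presented_group R" "bs_class m n x = presented_class R (free_gen x)"
  by (simp_all add: B_def R_def baumslag_solitar_def bs_class_def Let_def)

lemma bs_relation_carrier: "R \<subseteq> carrier free_group \<times> carrier free_group"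
proof -
  interpret F: group "free_group :: bs_gen word set monoid" by (rule group_free_group)
  show ?thesis by (simp add: R_def)
qed

lemma bs_class_carrier: "bs_class m n x \<in> carrier B"
  unfolding bs_presented
  by (rule group_hom.hom_closed[OF presented_class_group_hom]) simp

lemma generate_bs_classes: "generate B {bs_class m n Gen_a, bs_class m n Gen_t} = carrier B"
proof -
  have bs_gen_UNIV: "(UNIV :: bs_gen set) = {Gen_a, Gen_t}" using bs_gen.exhaust by blast
  have "range (\<lambda>x. presented_class R (free_gen x)) = {bs_class m n Gen_a, bs_class m n Gen_t}"
    unfolding bs_gen_UNIV bs_presented(2) by simp
  then show ?thesis using generate_presented_gens[of R] by (simp add: bs_presented(1))
qed

lemma bs_class_relation:
  "bs_class m n Gen_t \<otimes>\<^bsub>B\<^esub> bs_class m n Gen_a [^]\<^bsub>B\<^esub> m \<otimes>\<^bsub>B\<^esub> inv\<^bsub>B\<^esub> bs_class m n Gen_t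
    = bs_class m n Gen_a [^]\<^bsub>B\<^esub> n"
proof -
  interpret q: group_hom free_group B "presented_class R"
    unfolding bs_presented by (rule presented_class_group_hom)
  have "presented_class R (free_gen Gen_t \<otimes>\<^bsub>free_group\<^esub> free_gen Gen_a [^]\<^bsub>free_group\<^esub> m
      \<otimes>\<^bsub>free_group\<^esub> inv\<^bsub>free_group\<^esub> free_gen Gen_t)
    = presented_class R (free_gen Gen_a [^]\<^bsub>free_group\<^esub> n)"
    by (rule presented_class_relation[OF bs_relation_carrier]) (simp add: R_def)
  then show ?thesis
    by (simp add: bs_presented(2) q.hom_int_pow)
qed

lemma baumslag_solitar_lift:
  fixes \<alpha> \<tau> :: 'h
  assumes "group H" "\<alpha> \<in> carrier H" "\<tau> \<in> carrier H"
    and rel: "\<tau> \<otimes>\<^bsub>H\<^esub> \<alpha> [^]\<^bsub>H\<^esub> m \<otimes>\<^bsub>H\<^esub> inv\<^bsub>H\<^esub> \<tau> = \<alpha> [^]\<^bsub>H\<^esub> n"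
  obtains f where "f \<in> hom B H" "f (bs_class m n Gen_a) = \<alpha>" "f (bs_class m n Gen_t) = \<tau>"
proof -
  interpret H: group H by fact
  have "(case x of Gen_a \<Rightarrow> \<alpha> | Gen_t \<Rightarrow> \<tau>) \<in> carrier H" for x
    using assms by (cases x) simp_all
  then obtain h where h: "h \<in> hom free_group H"
    and hx: "\<And>x. h (free_gen x) = (case x of Gen_a \<Rightarrow> \<alpha> | Gen_t \<Rightarrow> \<tau>)"
    by (rule free_group_extend[OF \<open>group H\<close>, of "\<lambda>x. case x of Gen_a \<Rightarrow> \<alpha> | Gen_t \<Rightarrow> \<tau>"]) blast
  interpret h: group_hom free_group H h
    using h group_free_group H.is_group by (simp add: group_hom_def group_hom_axioms_def)
  have "h l = h r" if "(l, r) \<in> R" for l r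
    using that rel by (simp add: R_def hx h.hom_int_pow)
  from presented_group_lift[OF \<open>group H\<close> h bs_relation_carrier this]
  obtain f where "f \<in> hom B H" "\<And>w. w \<in> carrier free_group \<Longrightarrow> f (presented_class R w) = h w"
    unfolding bs_presented(1) by blast
  then show thesis using that[of f] by (simp add: bs_presented(2) hx)
qed

end

section \<open>Even parameter\<close>

text \<open>The wreath product of \<open>\<int>\<close> by \<open>\<int>/2\<close>: the Boolean component is the generator of \<open>\<int>/2\<close>, which swaps the two
  coordinates of \<open>\<int> \<times> \<int>\<close>.\<close>

definition swap_wreath :: "(int \<times> int \<times> bool) monoid" where
  "swap_wreath =
    \<lparr>carrier = UNIV,
     monoid.mult = (\<lambda>(i, j, b) (i', j', b'). if b then (i + j', j + i', \<not> b') else (i + i', j + j', b')),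
     one = (0, 0, False)\<rparr>"

lemma group_swap_wreath: "group swap_wreath"
proof (rule groupI)
  fix x assume "x \<in> carrier swap_wreath"
  obtain i j b where x: "x = (i, j, b)" by (cases x)
  have "(if b then (- j, - i, b) else (- i, - j, b)) \<otimes>\<^bsub>swap_wreath\<^esub> x = \<one>\<^bsub>swap_wreath\<^esub>"
    by (simp add: swap_wreath_def x)
  moreover have "(if b then (- j, - i, b) else (- i, - j, b)) \<in> carrier swap_wreath"
    by (simp add: swap_wreath_def)
  ultimately show "\<exists>y\<in>carrier swap_wreath. y \<otimes>\<^bsub>swap_wreath\<^esub> x = \<one>\<^bsub>swap_wreath\<^esub>"
    by blast
qed (auto simp: swap_wreath_def split: prod.splits)

text \<open>The kernel is that of \<open>a \<mapsto> 1, t \<mapsto> 0\<close>. It is the preimage of \<open>\<int> \<times> \<int>\<close> under the map to the wreath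
  product, so the two coordinates of that map are homomorphisms on it.\<close>

lemma baumslag_solitar_even:
  fixes n :: int
  assumes "even n"
  defines "B \<equiv> baumslag_solitar n (n + 2)"
  shows "\<exists>p \<in> hom B (integer_mod_group 2). p ` carrier B = {0, 1} \<and>
    two_avoidable (B\<lparr>carrier := kernel B (integer_mod_group 2) p\<rparr>)"
proof -
  interpret B: group B unfolding B_def by (rule group_baumslag_solitar)
  interpret W: group swap_wreath by (rule group_swap_wreath)
  define a where "a = bs_class n (n + 2) Gen_a"
  define t where "t = bs_class n (n + 2) Gen_t"
  obtain k where k: "n = 2 * k" using \<open>even n\<close> by (rule evenE)
  have at: "a \<in> carrier B" "t \<in> carrier B"
    unfolding a_def t_def B_def by (rule bs_class_carrier)+
  have gen: "generate B {a, t} = carrier B"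
    unfolding a_def t_def B_def by (rule generate_bs_classes)
  have rel: "t \<otimes>\<^bsub>B\<^esub> a [^]\<^bsub>B\<^esub> n \<otimes>\<^bsub>B\<^esub> inv\<^bsub>B\<^esub> t = a [^]\<^bsub>B\<^esub> (n + 2)"
    unfolding a_def t_def B_def by (rule bs_class_relation)
  let ?\<alpha> = "(0, 0, True) :: int \<times> int \<times> bool" and ?\<tau> = "(1, 0, False) :: int \<times> int \<times> bool"
  have W: "?\<alpha> \<in> carrier swap_wreath" "?\<tau> \<in> carrier swap_wreath" by (simp_all add: swap_wreath_def)
  have "?\<alpha> [^]\<^bsub>swap_wreath\<^esub> (2::int) = \<one>\<^bsub>swap_wreath\<^esub>"
    using W.int_pow_mult[OF W(1), of 1 1] W by simp (simp add: swap_wreath_def)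
  then have \<alpha>_even: "?\<alpha> [^]\<^bsub>swap_wreath\<^esub> (2 * j :: int) = \<one>\<^bsub>swap_wreath\<^esub>" for j
    using W.int_pow_pow[OF W(1), of 2 j] by simp
  have "?\<tau> \<otimes>\<^bsub>swap_wreath\<^esub> ?\<alpha> [^]\<^bsub>swap_wreath\<^esub> n \<otimes>\<^bsub>swap_wreath\<^esub> inv\<^bsub>swap_wreath\<^esub> ?\<tau>
      = ?\<alpha> [^]\<^bsub>swap_wreath\<^esub> (n + 2)"
    using \<alpha>_even[of k] \<alpha>_even[of "k + 1"] W by (simp add: k)
  from baumslag_solitar_lift[OF group_swap_wreath W this]
  obtain f where f: "f \<in> hom B swap_wreath" and fa: "f a = ?\<alpha>" and ft: "f t = ?\<tau>"
    unfolding B_def a_def t_def by blast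
  interpret f: group_hom B swap_wreath f by unfold_locales fact
  define p where "p = (\<lambda>(i, j, b). of_bool b :: int) \<circ> f"
  have p: "p \<in> hom B (integer_mod_group 2)"
    by (rule homI)
      (auto simp: p_def carrier_integer_mod_group f.hom_mult swap_wreath_def split: prod.splits)
  interpret p: group_hom B "integer_mod_group 2" p
    by (simp add: group_hom_def group_hom_axioms_def p)
  have pa: "p a = 1" and pt: "p t = 0" by (simp_all add: p_def fa ft)
  have "p ` carrier B \<subseteq> {0, 1}" by (auto simp: p_def split: prod.splits)
  then have onto: "p ` carrier B = {0, 1}" using at pa pt by (metis imageI insert_subset subset_antisym empty_subsetI)
  define K where "K = kernel B (integer_mod_group 2) p"
  have K: "subgroup K B" unfolding K_def by (rule p.subgroup_kernel)
  let ?G = "B\<lparr>carrier := K\<rparr>"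
  interpret G: group ?G using K by (rule B.subgroup_imp_group)
  have gens: "generate B {a \<otimes>\<^bsub>B\<^esub> a, t, a \<otimes>\<^bsub>B\<^esub> t \<otimes>\<^bsub>B\<^esub> inv\<^bsub>B\<^esub> a} = K" (is "generate B ?X = K")
    unfolding K_def using B.index_two_kernel_generators[OF p at(1) pa at(2) pt gen] by simp
  have XK: "?X \<subseteq> K" unfolding gens[symmetric] by (auto intro: generate.incl)
  have fK: "f g = (fst (f g), fst (snd (f g)), False)" if "g \<in> K" for g
    using that by (auto simp: K_def kernel_def p_def split: prod.splits)
  have f_mult: "f (g \<otimes>\<^bsub>B\<^esub> h) = (fst (f g) + fst (f h), fst (snd (f g)) + fst (snd (f h)), False)"
    if "g \<in> K" "h \<in> K" for g h
  proof -
    have "f (g \<otimes>\<^bsub>B\<^esub> h) = f g \<otimes>\<^bsub>swap_wreath\<^esub> f h"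
      using that subgroup.subset[OF K] by (intro f.hom_mult) blast+
    also have "\<dots> = (fst (f g), fst (snd (f g)), False) \<otimes>\<^bsub>swap_wreath\<^esub> (fst (f h), fst (snd (f h)), False)"
      using fK that by metis
    finally show ?thesis by (simp add: swap_wreath_def)
  qed
  have inv\<alpha>: "inv\<^bsub>swap_wreath\<^esub> ?\<alpha> = ?\<alpha>"
    by (rule W.inv_equality) (simp_all add: swap_wreath_def)
  have fu: "f (a \<otimes>\<^bsub>B\<^esub> t \<otimes>\<^bsub>B\<^esub> inv\<^bsub>B\<^esub> a) = (0, 1, False)"
    using at by (simp add: fa ft inv\<alpha>) (simp add: swap_wreath_def)
  have "two_avoidable ?G"
  proof (rule two_avoidable_free_abelianization)
    show "group ?G" ..
    show "generate ?G {a \<otimes>\<^bsub>B\<^esub> a, t, a \<otimes>\<^bsub>B\<^esub> t \<otimes>\<^bsub>B\<^esub> inv\<^bsub>B\<^esub> a} = carrier ?G"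
      using B.generate_consistent[OF XK K] gens by simp
    show "t \<in> carrier ?G" "a \<otimes>\<^bsub>B\<^esub> t \<otimes>\<^bsub>B\<^esub> inv\<^bsub>B\<^esub> a \<in> carrier ?G" "a \<otimes>\<^bsub>B\<^esub> a \<in> carrier ?G"
      using XK by auto
    have sq: "(a \<otimes>\<^bsub>B\<^esub> a) [^]\<^bsub>B\<^esub> j = a [^]\<^bsub>B\<^esub> (2 * j)" for j :: int
      using B.int_pow_pow[OF at(1), of 2 j] B.int_pow_mult[OF at(1), of 1 1] at by simp
    show "t \<otimes>\<^bsub>?G\<^esub> (a \<otimes>\<^bsub>B\<^esub> a) [^]\<^bsub>?G\<^esub> k \<otimes>\<^bsub>?G\<^esub> inv\<^bsub>?G\<^esub> t = (a \<otimes>\<^bsub>B\<^esub> a) [^]\<^bsub>?G\<^esub> (k + 1)"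
      using rel XK K
      by (simp add: B.m_inv_consistent sq k flip: B.int_pow_consistent)
    show "fst \<circ> f \<in> hom ?G integer_group" "fst \<circ> snd \<circ> f \<in> hom ?G integer_group"
      by (auto intro!: homI simp: f_mult)
  qed (simp_all add: ft fu)
  then show ?thesis unfolding K_def using p onto by (intro bexI[of _ p] conjI)
qed

section \<open>Odd parameter\<close>

text \<open>The semidirect product of \<open>\<int>/4\<close> with \<open>\<int>\<close>, where the generator of \<open>\<int>\<close> acts by inversion.\<close>

definition twisted_Z4 :: "(int \<times> int) monoid" where
  "twisted_Z4 =
    \<lparr>carrier = {0..<4} \<times> UNIV,
     monoid.mult = (\<lambda>(r, i) (r', i'). ((if even i then r + r' else r - r') mod 4, i + i')),
     one = (0, 0)\<rparr>"

lemma group_twisted_Z4: "group twisted_Z4"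
proof (rule groupI)
  fix x assume x: "x \<in> carrier twisted_Z4"
  obtain r i where ri: "x = (r, i)" by (cases x)
  have "((if even i then - r else r) mod 4, - i) \<otimes>\<^bsub>twisted_Z4\<^esub> x = \<one>\<^bsub>twisted_Z4\<^esub>"
    by (simp add: twisted_Z4_def ri mod_simps)
  moreover have "((if even i then - r else r) mod 4, - i) \<in> carrier twisted_Z4"
    by (simp add: twisted_Z4_def)
  ultimately show "\<exists>y\<in>carrier twisted_Z4. y \<otimes>\<^bsub>twisted_Z4\<^esub> x = \<one>\<^bsub>twisted_Z4\<^esub>"
    by blast
qed (auto simp: twisted_Z4_def mod_simps algebra_simps split: prod.splits)

text \<open>The kernel is that of \<open>a \<mapsto> 0, t \<mapsto> 1\<close>. Even elements of \<open>\<int>\<close> act trivially on \<open>\<int>/4\<close>, so on this kernel both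
  coordinates of the map to the semidirect product are homomorphisms.\<close>

lemma baumslag_solitar_odd:
  fixes n :: int
  assumes "odd n"
  defines "B \<equiv> baumslag_solitar n (n + 2)"
  shows "\<exists>p \<in> hom B (integer_mod_group 2). p ` carrier B = {0, 1} \<and>
    two_avoidable (B\<lparr>carrier := kernel B (integer_mod_group 2) p\<rparr>)"
proof -
  interpret B: group B unfolding B_def by (rule group_baumslag_solitar)
  interpret Q: group twisted_Z4 by (rule group_twisted_Z4)
  define a where "a = bs_class n (n + 2) Gen_a"
  define t where "t = bs_class n (n + 2) Gen_t"
  have at: "a \<in> carrier B" "t \<in> carrier B"
    unfolding a_def t_def B_def by (rule bs_class_carrier)+
  have gen: "generate B {t, a} = carrier B"
    using generate_bs_classes[of n "n + 2"] by (simp add: a_def t_def B_def insert_commute)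
  have rel: "t \<otimes>\<^bsub>B\<^esub> a [^]\<^bsub>B\<^esub> n \<otimes>\<^bsub>B\<^esub> inv\<^bsub>B\<^esub> t = a [^]\<^bsub>B\<^esub> (n + 2)"
    unfolding a_def t_def B_def by (rule bs_class_relation)
  let ?\<alpha> = "(1, 0) :: int \<times> int" and ?\<tau> = "(0, 1) :: int \<times> int"
  have Q: "?\<alpha> \<in> carrier twisted_Z4" "?\<tau> \<in> carrier twisted_Z4" by (simp_all add: twisted_Z4_def)
  have "(\<lambda>i. (i mod 4, 0)) \<in> hom integer_group twisted_Z4"
    by (rule homI) (auto simp: twisted_Z4_def mod_simps)
  \<comment> \<open>The \<open>i\<close>-th power of \<open>1\<close> in the additive group \<open>\<int>\<close> is \<open>i\<close>, so a homomorphism from \<open>\<int>\<close> computes powers.\<close>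
  from hom_int_pow[OF this, of 1]
  have \<alpha>_pow: "?\<alpha> [^]\<^bsub>twisted_Z4\<^esub> i = (i mod 4, 0)" for i :: int
    by (simp add: group_twisted_Z4)
  have "?\<tau> \<otimes>\<^bsub>twisted_Z4\<^esub> ?\<alpha> [^]\<^bsub>twisted_Z4\<^esub> n = ?\<alpha> [^]\<^bsub>twisted_Z4\<^esub> (n + 2) \<otimes>\<^bsub>twisted_Z4\<^esub> ?\<tau>"
    using \<open>odd n\<close> unfolding \<alpha>_pow by (simp add: twisted_Z4_def) presburger
  then have "?\<tau> \<otimes>\<^bsub>twisted_Z4\<^esub> ?\<alpha> [^]\<^bsub>twisted_Z4\<^esub> n \<otimes>\<^bsub>twisted_Z4\<^esub> inv\<^bsub>twisted_Z4\<^esub> ?\<tau>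
      = ?\<alpha> [^]\<^bsub>twisted_Z4\<^esub> (n + 2)"
    using Q by (simp add: Q.m_assoc)
  from baumslag_solitar_lift[OF group_twisted_Z4 Q this]
  obtain f where f: "f \<in> hom B twisted_Z4" and fa: "f a = ?\<alpha>" and ft: "f t = ?\<tau>"
    unfolding B_def a_def t_def by blast
  interpret f: group_hom B twisted_Z4 f by unfold_locales fact
  define p where "p = (\<lambda>(r, i). i mod 2) \<circ> f"
  have p: "p \<in> hom B (integer_mod_group 2)"
    by (rule homI)
      (auto simp: p_def carrier_integer_mod_group f.hom_mult twisted_Z4_def mod_simps split: prod.splits)
  interpret p: group_hom B "integer_mod_group 2" p
    by (simp add: group_hom_def group_hom_axioms_def p)
  have pa: "p a = 0" and pt: "p t = 1" by (simp_all add: p_def fa ft)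
  have "p ` carrier B \<subseteq> {0, 1}" by (auto simp: p_def split: prod.splits)
  then have onto: "p ` carrier B = {0, 1}" using at pa pt by (metis imageI insert_subset subset_antisym empty_subsetI)
  define K where "K = kernel B (integer_mod_group 2) p"
  have K: "subgroup K B" unfolding K_def by (rule p.subgroup_kernel)
  let ?G = "B\<lparr>carrier := K\<rparr>"
  interpret G: group ?G using K by (rule B.subgroup_imp_group)
  have gens: "generate B {t \<otimes>\<^bsub>B\<^esub> t, a, t \<otimes>\<^bsub>B\<^esub> a \<otimes>\<^bsub>B\<^esub> inv\<^bsub>B\<^esub> t} = K" (is "generate B ?X = K")
    unfolding K_def using B.index_two_kernel_generators[OF p at(2) pt at(1) pa gen] by simp
  have XK: "?X \<subseteq> K" unfolding gens[symmetric] by (auto intro: generate.incl)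
  have KB: "g \<in> carrier B" if "g \<in> K" for g using that subgroup.subset[OF K] by auto
  have f_mult: "f (g \<otimes>\<^bsub>B\<^esub> h) = ((fst (f g) + fst (f h)) mod 4, snd (f g) + snd (f h))"
    if "g \<in> K" "h \<in> K" for g h
  proof -
    have "even (snd (f g))"
      using that by (auto simp: K_def kernel_def p_def split: prod.splits)
    moreover have "f (g \<otimes>\<^bsub>B\<^esub> h) = f g \<otimes>\<^bsub>twisted_Z4\<^esub> f h"
      using that KB by simp
    ultimately show ?thesis
      by (cases "f g"; cases "f h") (simp add: twisted_Z4_def)
  qed
  have f_fst: "fst (f g) \<in> {0..<4}" if "g \<in> K" for g
    using f.hom_closed[OF KB[OF that]] by (auto simp: twisted_Z4_def)
  have inv\<tau>: "inv\<^bsub>twisted_Z4\<^esub> ?\<tau> = (0, - 1)"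
    by (rule Q.inv_equality) (simp_all add: twisted_Z4_def)
  have fb: "f (t \<otimes>\<^bsub>B\<^esub> a \<otimes>\<^bsub>B\<^esub> inv\<^bsub>B\<^esub> t) = (3, 0)"
    using at by (simp add: fa ft inv\<tau>) (simp add: twisted_Z4_def)
  have fs: "f (t \<otimes>\<^bsub>B\<^esub> t) = (0, 2)"
    using at by (simp add: ft) (simp add: twisted_Z4_def)
  have "two_avoidable ?G"
  proof (rule two_avoidable_cyclic_torsion)
    show "group ?G" ..
    show "generate ?G {t \<otimes>\<^bsub>B\<^esub> t, a, t \<otimes>\<^bsub>B\<^esub> a \<otimes>\<^bsub>B\<^esub> inv\<^bsub>B\<^esub> t} = carrier ?G"
      using B.generate_consistent[OF XK K] gens by simp
    show "t \<otimes>\<^bsub>B\<^esub> t \<in> carrier ?G" "a \<in> carrier ?G" "t \<otimes>\<^bsub>B\<^esub> a \<otimes>\<^bsub>B\<^esub> inv\<^bsub>B\<^esub> t \<in> carrier ?G"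
      using XK by auto
    show "odd n" by fact
    have "(t \<otimes>\<^bsub>B\<^esub> a \<otimes>\<^bsub>B\<^esub> inv\<^bsub>B\<^esub> t) [^]\<^bsub>B\<^esub> n = a [^]\<^bsub>B\<^esub> (n + 2)"
      using at rel by (simp add: B.conjugate_int_pow)
    then show "(t \<otimes>\<^bsub>B\<^esub> a \<otimes>\<^bsub>B\<^esub> inv\<^bsub>B\<^esub> t) [^]\<^bsub>?G\<^esub> n = a [^]\<^bsub>?G\<^esub> (n + 2)"
      using XK K by (simp flip: B.int_pow_consistent)
    show "snd \<circ> f \<in> hom ?G integer_group"
      by (auto intro!: homI simp: f_mult)
    show "fst \<circ> f \<in> hom ?G (integer_mod_group 4)"
      using f_fst by (intro homI) (simp_all add: f_mult carrier_integer_mod_group)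
  qed (simp_all add: fa fb fs)
  then show ?thesis unfolding K_def using p onto by (intro bexI[of _ p] conjI)
qed

section \<open>A 2-avoidable subgroup of index two\<close>

theorem proposition3p2:
  fixes n :: int
  shows "\<exists>\<Gamma>'. subgroup \<Gamma>' (baumslag_solitar n (n + 2)) \<and>
    card (rcosets\<^bsub>baumslag_solitar n (n + 2)\<^esub> \<Gamma>') = 2 \<and>
    two_avoidable ((baumslag_solitar n (n + 2))\<lparr>carrier := \<Gamma>'\<rparr>)"
proof -
  let ?B = "baumslag_solitar n (n + 2)" and ?Z2 = "integer_mod_group 2"
  obtain p where p: "p \<in> hom ?B ?Z2" and onto: "p ` carrier ?B = {0, 1}"
    and avoid: "two_avoidable (?B\<lparr>carrier := kernel ?B ?Z2 p\<rparr>)"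
    using baumslag_solitar_even[of n] baumslag_solitar_odd[of n] by (cases "even n") blast+
  interpret p: group_hom ?B ?Z2 p
    by (simp add: group_hom_def group_hom_axioms_def group_baumslag_solitar p)
  have Z2: "carrier ?Z2 = {0, 1}" by (auto simp: carrier_integer_mod_group)
  have "?B Mod kernel ?B ?Z2 p \<cong> ?Z2"
    using onto Z2 by (intro p.FactGroup_iso) simp
  then have "card (carrier (?B Mod kernel ?B ?Z2 p)) = card (carrier ?Z2)"
    by (rule iso_same_card)
  then have "card (rcosets\<^bsub>?B\<^esub> (kernel ?B ?Z2 p)) = 2"
    by (simp add: FactGroup_def Z2)
  then show ?thesis using p.subgroup_kernel avoid by blast
qed

end
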